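(* Let $X$ and $Y$ be uniformly discrete metric spaces with bounded geometry and let $f:X\to Y$ be a uniformly expansive map. Assume that $Y$ has property A. If for every uniformly bounded cover $\{U_i\}_{i\in I}$ of $Y$ the collection $\{f^{-1}(U_i)\}_{i\in I}$ of subspaces of $X$ is equi-strongly embeddable, then $X$ is strongly embeddable.
   Context: Bounded geometry: a metric space $X$ has bounded geometry if for all $R>0$ there is $N_R$ with $|B(x,R)|\le N_R$ for all $x\in X$. Uniformly discrete: there is $C>0$ with $d(x,y)\ge C$ for all distinct $x,y$. Balls: $B(x,S)=\{y: d(x,y)\le S\}$. Uniformly expansive: for every $R>0$ there is $S>0$ such that $d(x,x')\le R$ implies $d(f(x),f(x'))\le S$. Property A (in one of its equivalent forms for bounded geometry spaces): $Y$ has property A if for all $R,\epsilon>0$ there are a uniformly bounded cover $\{U_i\}_{i\in I}$ of $Y$ and a partition of unity $\{\phi_i\}_{i\in I}$ on $Y$ (functions $\phi_i:Y\to[0,1]$ with $\sum_i\phi_i(y)=1$ for every $y$), with each $\phi_i$ vanishing outside $U_i$, such that $\sum_{i\in I}|\phi_i(y)-\phi_i(y')|\le\epsilon$ whenever $d(y,y')\le R$. Strong embeddability: a metric space $X$ is strongly embeddable if for all $R,\epsilon>0$ there is a map $\beta:X\to \ell^2(X)$, $x\mapsto\beta_x$, with $\|\beta_x\|=1$ for all $x$, such that (1) $d(x,y)\le R$ implies $\|\beta_x-\beta_y\|\le\epsilon$ (called $(R,\epsilon)$ variation); (2) $\lim_{S\to\infty}\sup_{x\in X}\sum_{w\notin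 B(x,S)}|\beta_x(w)|^2=0$. Equi-strong embeddability: a family $(X_i)_{i\in I}$ of metric spaces is equi-strongly embeddable if for all $R,\epsilon>0$ there are maps $\xi^i:X_i\to\ell^2(X_i)$, $x\mapsto\xi^i_x$, with $\|\xi^i_x\|=1$, such that (1) each $\xi^i$ has $(R,\epsilon)$ variation; (2) $\lim_{S\to\infty}\sup_{i\in I}\sup_{x\in X_i}\sum_{w\in X_i\setminus B(x,S)}|\xi^i_x(w)|^2=0$. Subspaces carry the restricted metric. *)

theory Defs
  imports "HOL-Analysis.Analysis"
begin

text \<open>Metric spaces are subsets of a type of class \<open>metric_space\<close> with the restricted metric, so that
  subspaces (including the empty one) are again of this form. Uniform discreteness is the library's
  \<^const>\<open>uniform_discrete\<close>.\<close>

definition bounded_geometry :: "'a::metric_space set \<Rightarrow> bool" where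
  "bounded_geometry X \<longleftrightarrow>
     (\<forall>R>0. \<exists>N::nat. \<forall>x\<in>X. finite (X \<inter> cball x R) \<and> card (X \<inter> cball x R) \<le> N)"

definition uniformly_expansive_on ::
    "'a::metric_space set \<Rightarrow> ('a \<Rightarrow> 'b::metric_space) \<Rightarrow> bool" where
  "uniformly_expansive_on X f \<longleftrightarrow>
     (\<forall>R>0. \<exists>S>0. \<forall>x\<in>X. \<forall>x'\<in>X. dist x x' \<le> R \<longrightarrow> dist (f x) (f x') \<le> S)"

definition uniformly_bounded_cover ::
    "'b::metric_space set \<Rightarrow> 'i set \<Rightarrow> ('i \<Rightarrow> 'b set) \<Rightarrow> bool" where
  "uniformly_bounded_cover Y I U \<longleftrightarrow>
     (\<Union>i\<in>I. U i) = Y \<and> (\<exists>D. \<forall>i\<in>I. \<forall>y\<in>U i. \<forall>y'\<in>U i. dist y y' \<le> D)"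

definition partition_of_unity_on ::
    "'b set \<Rightarrow> 'i set \<Rightarrow> ('i \<Rightarrow> 'b \<Rightarrow> real) \<Rightarrow> bool" where
  "partition_of_unity_on Y I \<phi> \<longleftrightarrow>
     (\<forall>i\<in>I. \<forall>y\<in>Y. \<phi> i y \<in> {0..1}) \<and> (\<forall>y\<in>Y. ((\<lambda>i. \<phi> i y) has_sum 1) I)"

definition property_A_witness ::
    "'b::metric_space set \<Rightarrow> real \<Rightarrow> real \<Rightarrow> 'i set \<Rightarrow> ('i \<Rightarrow> 'b set) \<Rightarrow> ('i \<Rightarrow> 'b \<Rightarrow> real) \<Rightarrow> bool"
  where
  "property_A_witness Y R \<epsilon> I U \<phi> \<longleftrightarrow>
     uniformly_bounded_cover Y I U \<and> partition_of_unity_on Y I \<phi> \<and>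
     (\<forall>i\<in>I. \<forall>y\<in>Y - U i. \<phi> i y = 0) \<and>
     (\<forall>y\<in>Y. \<forall>y'\<in>Y. dist y y' \<le> R \<longrightarrow> (\<Sum>\<^sub>\<infinity>i\<in>I. \<bar>\<phi> i y - \<phi> i y'\<bar>) \<le> \<epsilon>)"

text \<open>An existential quantifier cannot range over all index types, so the index set is taken in
  \<^typ>\<open>'b set\<close>. By \<open>property_A_I\<close> below, witnesses over any other index type would do as well.\<close>

definition property_A :: "'b::metric_space set \<Rightarrow> bool" where
  "property_A Y \<longleftrightarrow>
     (\<forall>R>0. \<forall>\<epsilon>>0. \<exists>(I :: 'b set set) U \<phi>. property_A_witness Y R \<epsilon> I U \<phi>)"

text \<open>The (complex) Hilbert space of square-summable functions on \<open>X\<close>, as functions on the ambient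
  type vanishing off \<open>X\<close>.\<close>

definition ell2 :: "'a set \<Rightarrow> ('a \<Rightarrow> complex) set" where
  "ell2 X = {g. (\<forall>w. w \<notin> X \<longrightarrow> g w = 0) \<and> (\<lambda>w. (cmod (g w))\<^sup>2) summable_on X}"

definition ell2_norm :: "'a set \<Rightarrow> ('a \<Rightarrow> complex) \<Rightarrow> real" where
  "ell2_norm X g = sqrt (\<Sum>\<^sub>\<infinity>w\<in>X. (cmod (g w))\<^sup>2)"

definition unit_ell2_map :: "'a set \<Rightarrow> ('a \<Rightarrow> 'a \<Rightarrow> complex) \<Rightarrow> bool" where
  "unit_ell2_map X \<beta> \<longleftrightarrow> (\<forall>x\<in>X. \<beta> x \<in> ell2 X \<and> ell2_norm X (\<beta> x) = 1)"

definition has_variation ::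
    "real \<Rightarrow> real \<Rightarrow> 'a::metric_space set \<Rightarrow> ('a \<Rightarrow> 'a \<Rightarrow> complex) \<Rightarrow> bool" where
  "has_variation R \<epsilon> X \<beta> \<longleftrightarrow>
     (\<forall>x\<in>X. \<forall>y\<in>X. dist x y \<le> R \<longrightarrow> ell2_norm X (\<lambda>w. \<beta> x w - \<beta> y w) \<le> \<epsilon>)"

text \<open>The supremum is taken in \<^typ>\<open>ennreal\<close>, where the supremum over the empty set is \<open>0\<close>; preimages
  of members of a cover may be empty.\<close>

definition tail_sup ::
    "'a::metric_space set \<Rightarrow> ('a \<Rightarrow> 'a \<Rightarrow> complex) \<Rightarrow> real \<Rightarrow> ennreal" where
  "tail_sup X \<beta> S = (SUP x\<in>X. ennreal (\<Sum>\<^sub>\<infinity>w\<in>X - cball x S. (cmod (\<beta> x w))\<^sup>2))"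

definition strongly_embeddable :: "'a::metric_space set \<Rightarrow> bool" where
  "strongly_embeddable X \<longleftrightarrow>
     (\<forall>R>0. \<forall>\<epsilon>>0. \<exists>\<beta>. unit_ell2_map X \<beta> \<and> has_variation R \<epsilon> X \<beta> \<and>
        ((\<lambda>S. tail_sup X \<beta> S) \<longlongrightarrow> 0) at_top)"

definition equi_strongly_embeddable :: "'i set \<Rightarrow> ('i \<Rightarrow> 'a::metric_space set) \<Rightarrow> bool" where
  "equi_strongly_embeddable I X \<longleftrightarrow>
     (\<forall>R>0. \<forall>\<epsilon>>0. \<exists>\<xi>.
        (\<forall>i\<in>I. unit_ell2_map (X i) (\<xi> i) \<and> has_variation R \<epsilon> (X i) (\<xi> i)) \<and>
        ((\<lambda>S. SUP i\<in>I. tail_sup (X i) (\<xi> i) S) \<longlongrightarrow> 0) at_top)"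

text \<open>Independence of the index type: families of subsets of \<open>Y\<close> may be reindexed by the sets
  themselves, adding up the \<open>\<phi> i\<close> that belong to the same set.\<close>

lemma uniformly_bounded_cover_image:
  "uniformly_bounded_cover Y (U ` I) (\<lambda>V. V) \<longleftrightarrow> uniformly_bounded_cover Y I U"
  by (simp add: uniformly_bounded_cover_def)

lemma equi_strongly_embeddable_image:
  assumes "equi_strongly_embeddable (U ` I) X"
  shows "equi_strongly_embeddable I (\<lambda>i. X (U i))"
  unfolding equi_strongly_embeddable_def
proof (intro allI impI)
  fix R \<epsilon> :: real
  assume "R > 0" "\<epsilon> > 0"
  with assms obtain \<xi> where
      "\<forall>V\<in>U ` I. unit_ell2_map (X V) (\<xi> V) \<and> has_variation R \<epsilon> (X V) (\<xi> V)"
      "((\<lambda>S. SUP V\<in>U ` I. tail_sup (X V) (\<xi> V) S) \<longlongrightarrow> 0) at_top"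
    unfolding equi_strongly_embeddable_def by blast
  then show "\<exists>\<xi>. (\<forall>i\<in>I. unit_ell2_map (X (U i)) (\<xi> i) \<and> has_variation R \<epsilon> (X (U i)) (\<xi> i)) \<and>
      ((\<lambda>S. SUP i\<in>I. tail_sup (X (U i)) (\<xi> i) S) \<longlongrightarrow> 0) at_top"
    by (intro exI[of _ "\<lambda>i. \<xi> (U i)"]) (simp add: image_image)
qed

lemma equi_strongly_embeddable_any_index:
  fixes I :: "'i set" and Y :: "'b::metric_space set"
  assumes "\<And>(J :: 'b set set) V. uniformly_bounded_cover Y J V
             \<Longrightarrow> equi_strongly_embeddable J (\<lambda>j. {x\<in>X. f x \<in> V j})"
    and "uniformly_bounded_cover Y I U"
  shows "equi_strongly_embeddable I (\<lambda>i. {x\<in>X. f x \<in> U i})"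
proof -
  have "equi_strongly_embeddable (U ` I) (\<lambda>V. {x\<in>X. f x \<in> V})"
    using assms by (simp add: uniformly_bounded_cover_image)
  then show ?thesis
    by (rule equi_strongly_embeddable_image)
qed

lemma fibrewise_has_sum:
  fixes h :: "'i \<Rightarrow> real"
  assumes "h summable_on I"
  shows "((\<lambda>V. \<Sum>\<^sub>\<infinity>i\<in>{i\<in>I. U i = V}. h i) has_sum (\<Sum>\<^sub>\<infinity>i\<in>I. h i)) (U ` I)"
proof -
  let ?F = "\<lambda>V. {i\<in>I. U i = V}"
  have bij: "bij_betw snd (Sigma (U ` I) ?F) I"
    by (auto simp: bij_betw_def inj_on_def image_iff)
  have "(h has_sum (\<Sum>\<^sub>\<infinity>i\<in>I. h i)) I"
    using assms by simp
  then have "((\<lambda>p. h (snd p)) has_sum (\<Sum>\<^sub>\<infinity>i\<in>I. h i)) (Sigma (U ` I) ?F)"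
    using has_sum_reindex_bij_betw[OF bij] by blast
  moreover have "((\<lambda>i. h (snd (V, i))) has_sum (\<Sum>\<^sub>\<infinity>i\<in>?F V. h i)) (?F V)" for V
    using summable_on_subset_banach[OF assms, of "?F V"] by simp
  ultimately show ?thesis
    by (rule has_sum_SigmaD)
qed

lemma property_A_I:
  fixes Y :: "'b::metric_space set"
  assumes "\<And>R \<epsilon>. R > 0 \<Longrightarrow> \<epsilon> > 0 \<Longrightarrow> \<exists>(I :: 'i set) U \<phi>. property_A_witness Y R \<epsilon> I U \<phi>"
  shows "property_A Y"
  unfolding property_A_def
proof (intro allI impI)
  fix R \<epsilon> :: real
  assume "R > 0" "\<epsilon> > 0"
  then obtain I :: "'i set" and U \<phi> where w: "property_A_witness Y R \<epsilon> I U \<phi>"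
    using assms by blast
  let ?F = "\<lambda>V. {i\<in>I. U i = V}"
  define \<psi> where "\<psi> V y = (\<Sum>\<^sub>\<infinity>i\<in>?F V. \<phi> i y)" for V y
  have cover: "uniformly_bounded_cover Y I U"
    and range: "\<And>i y. i \<in> I \<Longrightarrow> y \<in> Y \<Longrightarrow> 0 \<le> \<phi> i y \<and> \<phi> i y \<le> 1"
    and sum1: "\<And>y. y \<in> Y \<Longrightarrow> ((\<lambda>i. \<phi> i y) has_sum 1) I"
    and supp: "\<And>i y. i \<in> I \<Longrightarrow> y \<in> Y \<Longrightarrow> y \<notin> U i \<Longrightarrow> \<phi> i y = 0"
    and var: "\<And>y y'. y \<in> Y \<Longrightarrow> y' \<in> Y \<Longrightarrow> dist y y' \<le> R
                \<Longrightarrow> (\<Sum>\<^sub>\<infinity>i\<in>I. \<bar>\<phi> i y - \<phi> i y'\<bar>) \<le> \<epsilon>"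
    using w by (auto simp: property_A_witness_def partition_of_unity_on_def)
  have smm: "(\<lambda>i. \<phi> i y) summable_on I" if "y \<in> Y" for y
    using sum1[OF that] by (rule has_sum_imp_summable)
  have smmF: "(\<lambda>i. \<phi> i y) summable_on ?F V" if "y \<in> Y" for y V
    by (rule summable_on_subset_banach[OF smm[OF that]]) auto
  have \<psi>_sum: "((\<lambda>V. \<psi> V y) has_sum 1) (U ` I)" if "y \<in> Y" for y
    using fibrewise_has_sum[OF smm[OF that], of U] infsumI[OF sum1[OF that]] by (simp add: \<psi>_def)
  have \<psi>_nonneg: "0 \<le> \<psi> V y" if "y \<in> Y" for V y
    unfolding \<psi>_def using range that by (intro infsum_nonneg) auto
  have \<psi>_le: "\<psi> V y \<le> 1" if "y \<in> Y" for V y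
  proof -
    have "\<psi> V y \<le> (\<Sum>\<^sub>\<infinity>i\<in>I. \<phi> i y)"
      unfolding \<psi>_def using smm smmF range that by (intro infsum_mono2) auto
    then show ?thesis
      using infsumI[OF sum1[OF that]] by simp
  qed
  have \<psi>_supp: "\<psi> V y = 0" if "y \<in> Y" "y \<notin> V" for V y
    unfolding \<psi>_def using supp that by (intro infsum_0) auto
  have \<psi>_var: "(\<Sum>\<^sub>\<infinity>V\<in>U ` I. \<bar>\<psi> V y - \<psi> V y'\<bar>) \<le> \<epsilon>"
    if y: "y \<in> Y" "y' \<in> Y" "dist y y' \<le> R" for y y'
  proof -
    let ?h = "\<lambda>i. \<bar>\<phi> i y - \<phi> i y'\<bar>"
    have diff: "(\<lambda>i. \<phi> i y - \<phi> i y') summable_on I"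
      using summable_on_add[OF smm[OF y(1)] summable_on_uminus[THEN iffD2, OF smm[OF y(2)]]] by simp
    then have h: "?h summable_on I"
      using summable_on_iff_abs_summable_on_real by force
    have hF: "?h summable_on ?F V" for V
      by (rule summable_on_subset_banach[OF h]) auto
    have le: "\<bar>\<psi> V y - \<psi> V y'\<bar> \<le> (\<Sum>\<^sub>\<infinity>i\<in>?F V. ?h i)" for V
    proof -
      have "\<psi> V y - \<psi> V y' = (\<Sum>\<^sub>\<infinity>i\<in>?F V. \<phi> i y - \<phi> i y')"
        unfolding \<psi>_def
        using infsum_add[OF smmF[OF y(1)] summable_on_uminus[THEN iffD2, OF smmF[OF y(2)]], of V]
        by (simp add: infsum_uminus)
      then show ?thesis
        using norm_infsum_bound[of "\<lambda>i. \<phi> i y - \<phi> i y'" "?F V"] hF[of V] by simp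
    qed
    note H = fibrewise_has_sum[OF h, of U]
    have smm': "(\<lambda>V. \<bar>\<psi> V y - \<psi> V y'\<bar>) summable_on U ` I"
      using Infinite_Sum.abs_summable_on_comparison_test'[OF has_sum_imp_summable[OF H],
          of "\<lambda>V. \<psi> V y - \<psi> V y'"] le by simp
    have "(\<Sum>\<^sub>\<infinity>V\<in>U ` I. \<bar>\<psi> V y - \<psi> V y'\<bar>) \<le> (\<Sum>\<^sub>\<infinity>V\<in>U ` I. \<Sum>\<^sub>\<infinity>i\<in>?F V. ?h i)"
      using smm' has_sum_imp_summable[OF H] le by (intro infsum_mono) auto
    also have "\<dots> = (\<Sum>\<^sub>\<infinity>i\<in>I. ?h i)"
      using H by (rule infsumI)
    also have "\<dots> \<le> \<epsilon>"
      using var y by blast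
    finally show ?thesis .
  qed
  have "property_A_witness Y R \<epsilon> (U ` I) (\<lambda>V. V) \<psi>"
    unfolding property_A_witness_def partition_of_unity_on_def
    using cover \<psi>_sum \<psi>_nonneg \<psi>_le \<psi>_supp \<psi>_var
    by (auto simp: uniformly_bounded_cover_image)
  then show "\<exists>(I :: 'b set set) U \<phi>. property_A_witness Y R \<epsilon> I U \<phi>"
    by blast
qed

end

theory Submission
  imports Defs
begin

text \<open>Given \<open>R\<close>, choose \<open>S\<close> by expansiveness, a property A partition of unity \<open>\<phi>\<close> subordinate to a
  cover \<open>U\<close>, and unit vectors \<open>\<xi> i\<close> for the preimages of the \<open>S\<close>-neighbourhoods of the \<open>U i\<close>, so
  that \<open>\<xi> i\<close> is defined at both of two \<open>R\<close>-close points as soon as \<open>\<phi> i\<close> is nonzero at the image of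
  one of them. The vectors \<open>\<Oplus>\<^sub>i sqrt (\<phi> i (f x)) \<xi> i x\<close> then have small variation and uniformly small
  tails, but live in \<open>\<ell>\<^sup>2(I \<times> X)\<close>. Taking the \<open>\<ell>\<^sup>2(I)\<close>-norm at every \<open>w\<close> maps them to \<open>\<ell>\<^sup>2(X)\<close>; this
  preserves norms and tails and, by the reverse triangle inequality, does not increase distances.\<close>

section \<open>Square-summable families and their fibrewise norms\<close>

lemma summable_on_diff_square:
  fixes p q :: "'i \<Rightarrow> real"
  assumes "(\<lambda>i. (p i)\<^sup>2) summable_on I" and "(\<lambda>i. (q i)\<^sup>2) summable_on I"
  shows "(\<lambda>i. (p i - q i)\<^sup>2) summable_on I"
proof (rule summable_on_comparison_test)
  show "(\<lambda>i. 2 * (p i)\<^sup>2 + 2 * (q i)\<^sup>2) summable_on I"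
    by (intro summable_on_add summable_on_cmult_right assms)
  show "(p i - q i)\<^sup>2 \<le> 2 * (p i)\<^sup>2 + 2 * (q i)\<^sup>2" for i
    using zero_le_power2[of "p i + q i"] by (simp add: power2_eq_square algebra_simps)
qed auto

text \<open>The reverse triangle inequality of \<open>\<ell>\<^sup>2(I)\<close>, squared. On finite
  subsets of \<open>I\<close> it follows from the triangle inequality for \<open>L2_set\<close>;
  summability of both squares lets it pass to the limit along
  \<open>finite_subsets_at_top I\<close>.\<close>

lemma sqrt_infsum_square_diff_le:
  fixes p q :: "'i \<Rightarrow> real"
  assumes p: "(\<lambda>i. (p i)\<^sup>2) summable_on I" and q: "(\<lambda>i. (q i)\<^sup>2) summable_on I"
  shows "(sqrt (\<Sum>\<^sub>\<infinity>i\<in>I. (p i)\<^sup>2) - sqrt (\<Sum>\<^sub>\<infinity>i\<in>I. (q i)\<^sup>2))\<^sup>2 \<le> (\<Sum>\<^sub>\<infinity>i\<in>I. (p i - q i)\<^sup>2)"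
proof (rule tendsto_le)
  let ?F = "finite_subsets_at_top I"
  show "?F \<noteq> bot" by simp
  have lim: "((\<lambda>F. \<Sum>i\<in>F. h i) \<longlongrightarrow> (\<Sum>\<^sub>\<infinity>i\<in>I. h i)) ?F" if "h summable_on I" for h :: "'i \<Rightarrow> real"
    using has_sum_infsum[OF that] by (simp add: has_sum_def)
  show "((\<lambda>F. \<Sum>i\<in>F. (p i - q i)\<^sup>2) \<longlongrightarrow> (\<Sum>\<^sub>\<infinity>i\<in>I. (p i - q i)\<^sup>2)) ?F"
    by (rule lim[OF summable_on_diff_square[OF p q]])
  show "((\<lambda>F. (L2_set p F - L2_set q F)\<^sup>2)
      \<longlongrightarrow> (sqrt (\<Sum>\<^sub>\<infinity>i\<in>I. (p i)\<^sup>2) - sqrt (\<Sum>\<^sub>\<infinity>i\<in>I. (q i)\<^sup>2))\<^sup>2) ?F"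
    unfolding L2_set_def by (intro tendsto_intros lim p q)
  have "(L2_set p F - L2_set q F)\<^sup>2 \<le> (\<Sum>i\<in>F. (p i - q i)\<^sup>2)" for F
  proof -
    have "L2_set p F \<le> L2_set (\<lambda>i. p i - q i) F + L2_set q F"
      using L2_set_triangle_ineq[of "\<lambda>i. p i - q i" q F] by simp
    moreover have "L2_set q F \<le> L2_set (\<lambda>i. p i - q i) F + L2_set p F"
      using L2_set_triangle_ineq[of "\<lambda>i. q i - p i" p F]
      by (simp add: L2_set_def power2_commute[of "p _" "q _"])
    ultimately have "\<bar>L2_set p F - L2_set q F\<bar> \<le> L2_set (\<lambda>i. p i - q i) F"
      by linarith
    then have "(L2_set p F - L2_set q F)\<^sup>2 \<le> (L2_set (\<lambda>i. p i - q i) F)\<^sup>2"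
      using power_mono[of "\<bar>L2_set p F - L2_set q F\<bar>" _ 2] by simp
    also have "\<dots> = (\<Sum>i\<in>F. (p i - q i)\<^sup>2)"
      by (simp add: L2_set_def sum_nonneg)
    finally show ?thesis .
  qed
  then show "\<forall>\<^sub>F F in ?F. (L2_set p F - L2_set q F)\<^sup>2 \<le> (\<Sum>i\<in>F. (p i - q i)\<^sup>2)"
    by simp
qed

text \<open>Tonelli for nonnegative families: row sums \<open>g i\<close> that are summable make
  \<open>h\<close> summable over \<open>I \<times> W\<close>, so the columns converge and summing by
  columns gives the same total.\<close>

lemma nonneg_iterated_has_sum:
  fixes h :: "'i \<Rightarrow> 'w \<Rightarrow> real"
  assumes h: "\<And>i. i \<in> I \<Longrightarrow> (h i has_sum g i) W" and g: "(g has_sum s) I"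
    and nonneg: "\<And>i w. i \<in> I \<Longrightarrow> w \<in> W \<Longrightarrow> 0 \<le> h i w"
  shows nonneg_iterated_summable_on: "w \<in> W \<Longrightarrow> (\<lambda>i. h i w) summable_on I"
    and nonneg_iterated_has_sum_swap: "((\<lambda>w. \<Sum>\<^sub>\<infinity>i\<in>I. h i w) has_sum s) W"
proof -
  have "(\<lambda>(i, w). h i w) summable_on I \<times> W"
    using h g nonneg by (intro summable_on_SigmaI[where g = g]) (auto intro: has_sum_imp_summable)
  then have "((\<lambda>(i, w). h i w) has_sum s) (I \<times> W)"
    using h g by (intro has_sum_SigmaI[where g = g]) auto
  then have swap: "((\<lambda>(w, i). h i w) has_sum s) (W \<times> I)"
    by (subst (asm) has_sum_swap) simp
  then show summable: "(\<lambda>i. h i w) summable_on I" if "w \<in> W" for w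
    using that by (intro summable_on_SigmaD1[of "\<lambda>w i. h i w"]) (auto dest: has_sum_imp_summable)
  show "((\<lambda>w. \<Sum>\<^sub>\<infinity>i\<in>I. h i w) has_sum s) W"
    using summable by (intro has_sum_SigmaD[OF swap]) auto
qed

text \<open>Taking the \<open>\<ell>\<^sup>2(I)\<close>-norm at each \<open>w\<close> is a
  contraction from \<open>\<ell>\<^sup>2(I \<times> W)\<close> to \<open>\<ell>\<^sup>2(W)\<close>:
  the reverse triangle inequality holds at each \<open>w\<close>, and Tonelli turns the resulting
  double sum into a sum over rows. The squared distance then only has to be estimated row by row, by
  \<open>d\<close>.\<close>

lemma infsum_fibre_norm_diff_le:
  fixes p q :: "'i \<Rightarrow> 'w \<Rightarrow> real"
  assumes p: "\<And>i. i \<in> I \<Longrightarrow> ((\<lambda>w. (p i w)\<^sup>2) has_sum a i) W" "a summable_on I"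
    and q: "\<And>i. i \<in> I \<Longrightarrow> ((\<lambda>w. (q i w)\<^sup>2) has_sum b i) W" "b summable_on I"
    and d: "\<And>i. i \<in> I \<Longrightarrow> (\<Sum>\<^sub>\<infinity>w\<in>W. (p i w - q i w)\<^sup>2) \<le> d i" "d summable_on I"
  shows "(\<Sum>\<^sub>\<infinity>w\<in>W. (sqrt (\<Sum>\<^sub>\<infinity>i\<in>I. (p i w)\<^sup>2) - sqrt (\<Sum>\<^sub>\<infinity>i\<in>I. (q i w)\<^sup>2))\<^sup>2) \<le> (\<Sum>\<^sub>\<infinity>i\<in>I. d i)"
proof -
  let ?e = "\<lambda>i. \<Sum>\<^sub>\<infinity>w\<in>W. (p i w - q i w)\<^sup>2"
  have P: "(\<lambda>i. (p i w)\<^sup>2) summable_on I" if "w \<in> W" for w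
    using p(1) has_sum_infsum[OF p(2)] that
    by (intro nonneg_iterated_summable_on[where g = a and W = W]) auto
  have Q: "(\<lambda>i. (q i w)\<^sup>2) summable_on I" if "w \<in> W" for w
    using q(1) has_sum_infsum[OF q(2)] that
    by (intro nonneg_iterated_summable_on[where g = b and W = W]) auto
  have rows: "((\<lambda>w. (p i w - q i w)\<^sup>2) has_sum ?e i) W" if "i \<in> I" for i
    using summable_on_diff_square[OF has_sum_imp_summable has_sum_imp_summable, OF p(1) q(1)] that
    by simp
  have e: "?e summable_on I"
    using d by (intro summable_on_comparison_test[OF d(2)] infsum_nonneg) auto
  have cols: "((\<lambda>w. \<Sum>\<^sub>\<infinity>i\<in>I. (p i w - q i w)\<^sup>2) has_sum (\<Sum>\<^sub>\<infinity>i\<in>I. ?e i)) W"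
    using rows e by (intro nonneg_iterated_has_sum_swap[where g = ?e]) auto
  have le: "(sqrt (\<Sum>\<^sub>\<infinity>i\<in>I. (p i w)\<^sup>2) - sqrt (\<Sum>\<^sub>\<infinity>i\<in>I. (q i w)\<^sup>2))\<^sup>2 \<le> (\<Sum>\<^sub>\<infinity>i\<in>I. (p i w - q i w)\<^sup>2)"
    if "w \<in> W" for w
    using sqrt_infsum_square_diff_le[OF P Q] that by simp
  have "(\<Sum>\<^sub>\<infinity>w\<in>W. (sqrt (\<Sum>\<^sub>\<infinity>i\<in>I. (p i w)\<^sup>2) - sqrt (\<Sum>\<^sub>\<infinity>i\<in>I. (q i w)\<^sup>2))\<^sup>2)
      \<le> (\<Sum>\<^sub>\<infinity>w\<in>W. \<Sum>\<^sub>\<infinity>i\<in>I. (p i w - q i w)\<^sup>2)"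
  proof (rule infsum_mono)
    show "(\<lambda>w. (sqrt (\<Sum>\<^sub>\<infinity>i\<in>I. (p i w)\<^sup>2) - sqrt (\<Sum>\<^sub>\<infinity>i\<in>I. (q i w)\<^sup>2))\<^sup>2) summable_on W"
      using le by (rule summable_on_comparison_test[OF has_sum_imp_summable[OF cols]]) auto
  qed (use le cols in \<open>auto intro: has_sum_imp_summable\<close>)
  also have "\<dots> = (\<Sum>\<^sub>\<infinity>i\<in>I. ?e i)"
    using cols by (rule infsumI)
  also have "\<dots> \<le> (\<Sum>\<^sub>\<infinity>i\<in>I. d i)"
    using e d by (intro infsum_mono) auto
  finally show ?thesis .
qed

text \<open>First the vector changes under the fixed weight \<open>a\<close> (the term
  \<open>s\<close>), then the weight changes under the fixed vector \<open>v\<close> (the term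
  \<open>t\<close>). The square of \<open>\<bar>sqrt a - sqrt b\<bar>\<close> is at most
  \<open>\<bar>a - b\<bar>\<close>, because one factor can be enlarged to
  \<open>sqrt a + sqrt b\<close>. This is what turns the \<open>\<ell>\<^sup>1\<close> variation of
  property A into an \<open>\<ell>\<^sup>2\<close> variation.\<close>

lemma weighted_square_diff_le:
  fixes a b :: real and u v :: complex
  assumes "0 \<le> a" "0 \<le> b"
  shows "(sqrt a * cmod u - sqrt b * cmod v)\<^sup>2 \<le> 2 * a * (cmod (u - v))\<^sup>2 + 2 * \<bar>a - b\<bar> * (cmod v)\<^sup>2"
proof -
  define s where "s = sqrt a * (cmod u - cmod v)"
  define t where "t = (sqrt a - sqrt b) * cmod v"
  have "(cmod u - cmod v)\<^sup>2 \<le> (cmod (u - v))\<^sup>2"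
    using power_mono[OF norm_triangle_ineq3[of u v], of 2] by simp
  then have s: "s\<^sup>2 \<le> a * (cmod (u - v))\<^sup>2"
    using assms by (simp add: s_def power_mult_distrib mult_left_mono)
  have "\<bar>sqrt a - sqrt b\<bar> \<le> sqrt a + sqrt b"
    using assms by (smt (verit) real_sqrt_ge_zero)
  then have "(sqrt a - sqrt b)\<^sup>2 \<le> \<bar>sqrt a - sqrt b\<bar> * (sqrt a + sqrt b)"
    by (metis abs_ge_zero abs_mult_self_eq mult_left_mono power2_eq_square)
  also have "\<dots> = \<bar>(sqrt a - sqrt b) * (sqrt a + sqrt b)\<bar>"
    using assms by (simp add: abs_mult)
  also have "(sqrt a - sqrt b) * (sqrt a + sqrt b) = a - b"
    using assms by (simp add: algebra_simps)
  finally have t: "t\<^sup>2 \<le> \<bar>a - b\<bar> * (cmod v)\<^sup>2"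
    by (simp add: t_def power_mult_distrib mult_right_mono)
  have "sqrt a * cmod u - sqrt b * cmod v = s + t"
    by (simp add: s_def t_def algebra_simps)
  moreover have "(s + t)\<^sup>2 \<le> 2 * s\<^sup>2 + 2 * t\<^sup>2"
    using zero_le_power2[of "s - t"] by (simp add: power2_eq_square algebra_simps)
  ultimately show ?thesis
    using s t by simp
qed

section \<open>Unit vectors, variation and thickened covers\<close>

lemma unit_ell2_mapD:
  assumes "unit_ell2_map X \<beta>" "x \<in> X"
  shows "w \<notin> X \<Longrightarrow> \<beta> x w = 0" and "((\<lambda>w. (cmod (\<beta> x w))\<^sup>2) has_sum 1) X"
proof -
  have "\<beta> x \<in> ell2 X" and "ell2_norm X (\<beta> x) = 1"
    using assms by (auto simp: unit_ell2_map_def)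
  then show "w \<notin> X \<Longrightarrow> \<beta> x w = 0" and "((\<lambda>w. (cmod (\<beta> x w))\<^sup>2) has_sum 1) X"
    by (auto simp: ell2_def ell2_norm_def has_sum_infsum dest: has_sum_infsum)
qed

lemma has_variation_infsum_le:
  assumes "has_variation R \<epsilon> X \<beta>" "x \<in> X" "y \<in> X" "dist x y \<le> R"
  shows "(\<Sum>\<^sub>\<infinity>w\<in>X. (cmod (\<beta> x w - \<beta> y w))\<^sup>2) \<le> \<epsilon>\<^sup>2"
proof -
  have "sqrt (\<Sum>\<^sub>\<infinity>w\<in>X. (cmod (\<beta> x w - \<beta> y w))\<^sup>2) \<le> \<epsilon>"
    using assms by (auto simp: has_variation_def ell2_norm_def)
  then show ?thesis
    by (rule sqrt_le_D)
qed

text \<open>Thickening by \<open>S\<close> adds at most \<open>2 * S\<close> to the bound on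
  diameters, and \<open>0 \<le> S\<close> keeps each \<open>U i\<close> inside its neighbourhood.
  Cutting down to \<open>Y\<close> makes the union exactly \<open>Y\<close>.\<close>

lemma uniformly_bounded_cover_neighbourhood:
  assumes "uniformly_bounded_cover Y I U" and "0 \<le> S"
  shows "uniformly_bounded_cover Y I (\<lambda>i. {y\<in>Y. \<exists>u\<in>U i. dist u y \<le> S})"
proof -
  obtain D where D: "\<And>i y y'. i \<in> I \<Longrightarrow> y \<in> U i \<Longrightarrow> y' \<in> U i \<Longrightarrow> dist y y' \<le> D"
    and Y: "(\<Union>i\<in>I. U i) = Y"
    using assms by (auto simp: uniformly_bounded_cover_def)
  have "dist y y' \<le> S + D + S"
    if "i \<in> I" "u \<in> U i" "dist u y \<le> S" "u' \<in> U i" "dist u' y' \<le> S" for i u u' y y'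
    using D[OF that(1,2,4)] that dist_triangle[of y y' u] dist_triangle[of u y' u']
    by (simp add: dist_commute)
  moreover have "(\<Union>i\<in>I. {y\<in>Y. \<exists>u\<in>U i. dist u y \<le> S}) = Y"
    using Y assms(2) by force
  ultimately show ?thesis
    unfolding uniformly_bounded_cover_def by blast
qed

theorem proposition4p1:
  fixes X :: "'a::metric_space set" and Y :: "'b::metric_space set" and f :: "'a \<Rightarrow> 'b"
  assumes "uniform_discrete X" and "bounded_geometry X"
    and "uniform_discrete Y" and "bounded_geometry Y"
    and "f \<in> X \<rightarrow> Y" and "uniformly_expansive_on X f"
    and "property_A Y"
    and "\<And>(I :: 'b set set) U. uniformly_bounded_cover Y I U
           \<Longrightarrow> equi_strongly_embeddable I (\<lambda>i. {x\<in>X. f x \<in> U i})"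
  shows "strongly_embeddable X"
  unfolding strongly_embeddable_def
proof (intro allI impI)
  fix R \<epsilon> :: real
  assume R: "R > 0" and \<epsilon>: "\<epsilon> > 0"

  \<comment> \<open>Choice of the partition of unity and of the local unit vectors\<close>
  obtain S where S: "S > 0"
    and expansive: "\<And>x x'. x \<in> X \<Longrightarrow> x' \<in> X \<Longrightarrow> dist x x' \<le> R \<Longrightarrow> dist (f x) (f x') \<le> S"
    using assms(6) R unfolding uniformly_expansive_on_def by metis
  \<comment> \<open>The squared variation of \<open>\<beta>\<close> will be at most twice the
    squared variation of the \<open>\<xi> i\<close> plus twice that of the weights. The choices
    \<open>\<epsilon> / 2\<close> and \<open>\<epsilon>\<^sup>2 / 4\<close> give each half of
    \<open>\<epsilon>\<^sup>2\<close>. The scale in \<open>Y\<close> is \<open>S\<close>, since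
    \<open>f\<close> carries \<open>R\<close>-close points to \<open>S\<close>-close ones.\<close>
  have "\<epsilon>\<^sup>2 / 4 > 0"
    using \<epsilon> by simp
  then obtain I :: "'b set set" and U \<phi> where A: "property_A_witness Y S (\<epsilon>\<^sup>2 / 4) I U \<phi>"
    using assms(7) S unfolding property_A_def by blast
  define V where "V i = {y\<in>Y. \<exists>u\<in>U i. dist u y \<le> S}" for i
  define Z where "Z i = {x\<in>X. f x \<in> V i}" for i
  have "uniformly_bounded_cover Y I V"
    using uniformly_bounded_cover_neighbourhood[of Y I U S] A S
    by (simp add: property_A_witness_def V_def[abs_def])
  then have "equi_strongly_embeddable I Z"
    unfolding Z_def by (rule assms(8))
  moreover have "\<epsilon> / 2 > 0"
    using \<epsilon> by simp
  ultimately obtain \<xi> where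
      \<xi>: "\<And>i. i \<in> I \<Longrightarrow> unit_ell2_map (Z i) (\<xi> i)"
      "\<And>i. i \<in> I \<Longrightarrow> has_variation R (\<epsilon> / 2) (Z i) (\<xi> i)"
    and tail: "((\<lambda>S. SUP i\<in>I. tail_sup (Z i) (\<xi> i) S) \<longlongrightarrow> 0) at_top"
    unfolding equi_strongly_embeddable_def using R by blast

  \<comment> \<open>The glued unit vectors\<close>
  define a where "a x i = \<phi> i (f x)" for x i
  \<comment> \<open>For \<open>x \<in> X - Z i\<close> nothing is known about
    \<open>\<xi> i x\<close>, but there the weight \<open>a x i\<close> is zero by
    \<open>Z_of_a\<close>. Only moduli of \<open>\<xi>\<close> are kept, as the norm over
    \<open>i\<close> ignores phases.\<close>
  define p where "p x i w = sqrt (a x i) * cmod (\<xi> i x w)" for x i w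
  define \<beta> where "\<beta> x w = complex_of_real (sqrt (\<Sum>\<^sub>\<infinity>i\<in>I. (p x i w)\<^sup>2))" for x w
  have fY: "f x \<in> Y" if "x \<in> X" for x
    using assms(5) that by auto
  have a_nonneg: "0 \<le> a x i" if "x \<in> X" "i \<in> I" for x i
    using A fY[OF that(1)] that(2)
    by (simp add: a_def property_A_witness_def partition_of_unity_on_def)
  have a_sum: "(a x has_sum 1) I" if "x \<in> X" for x
    using A fY[OF that] by (simp add: a_def[abs_def] property_A_witness_def partition_of_unity_on_def)
  have U_of_a: "f x \<in> U i" if "x \<in> X" "i \<in> I" "a x i \<noteq> 0" for x i
    using A fY[OF that(1)] that(2,3) unfolding a_def property_A_witness_def by blast
  have Z_near: "y \<in> Z i" if "x \<in> X" "y \<in> X" "dist x y \<le> R" "i \<in> I" "a x i \<noteq> 0" for x y i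
    using U_of_a[of x i] expansive[of x y] fY[of y] that by (auto simp: Z_def V_def)
  have Z_of_a: "x \<in> Z i" if "x \<in> X" "i \<in> I" "a x i \<noteq> 0" for x i
    using Z_near[of x x i] that R by simp
  have ZX: "Z i \<subseteq> X" for i
    by (auto simp: Z_def)
  have a_var: "(\<Sum>\<^sub>\<infinity>i\<in>I. \<bar>a x i - a y i\<bar>) \<le> \<epsilon>\<^sup>2 / 4"
    if "x \<in> X" "y \<in> X" "dist x y \<le> R" for x y
    using A fY[OF that(1)] fY[OF that(2)] expansive[OF that] unfolding a_def property_A_witness_def by blast
  have p_sq: "(p x i w)\<^sup>2 = a x i * (cmod (\<xi> i x w))\<^sup>2" if "x \<in> X" "i \<in> I" for x i w
    using a_nonneg[OF that] by (simp add: p_def power_mult_distrib)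
  have \<xi>_0: "\<xi> i x w = 0" if "x \<in> Z i" "i \<in> I" "w \<notin> Z i" for x i w
    using unit_ell2_mapD(1)[OF \<xi>(1)] that by blast
  \<comment> \<open>Since \<open>\<xi> i x\<close> vanishes off \<open>Z i\<close>, it may be
    treated as a unit vector of \<open>\<ell>\<^sup>2(X)\<close>; all rows then share the index set
    \<open>X\<close>.\<close>
  have \<xi>_sum: "((\<lambda>w. (cmod (\<xi> i x w))\<^sup>2) has_sum 1) X" if "x \<in> Z i" "i \<in> I" for x i
    using unit_ell2_mapD(2)[OF \<xi>(1), of i x] ZX[of i] \<xi>_0 that
    by (subst has_sum_cong_neutral[where T = "Z i" and g = "\<lambda>w. (cmod (\<xi> i x w))\<^sup>2"]) auto
  have p_row: "((\<lambda>w. (p x i w)\<^sup>2) has_sum a x i) X" if x: "x \<in> X" "i \<in> I" for x i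
  proof (cases "a x i = 0")
    case True
    then show ?thesis by (simp add: p_sq x)
  next
    case False
    then show ?thesis
      using has_sum_cmult_right[OF \<xi>_sum[OF Z_of_a], of x i "a x i"] x by (simp add: p_sq x)
  qed
  have \<beta>_sq: "(cmod (\<beta> x w))\<^sup>2 = (\<Sum>\<^sub>\<infinity>i\<in>I. (p x i w)\<^sup>2)" for x w
    by (simp add: \<beta>_def infsum_nonneg)
  have \<beta>_sum: "((\<lambda>w. (cmod (\<beta> x w))\<^sup>2) has_sum 1) X" if "x \<in> X" for x
    unfolding \<beta>_sq using p_row a_sum that by (intro nonneg_iterated_has_sum_swap[where g = "a x"]) auto
  have \<beta>_0: "\<beta> x w = 0" if "x \<in> X" "w \<notin> X" for x w
  proof -
    have "(p x i w)\<^sup>2 = 0" if "i \<in> I" for i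
      using \<xi>_0[of x i w] Z_of_a[of x i] ZX[of i] that \<open>x \<in> X\<close> \<open>w \<notin> X\<close>
      by (cases "a x i = 0") (auto simp: p_sq)
    then show ?thesis
      by (simp add: \<beta>_def infsum_0)
  qed
  have "unit_ell2_map X \<beta>"
    unfolding unit_ell2_map_def ell2_def ell2_norm_def
    using \<beta>_sum \<beta>_0 by (auto intro: has_sum_imp_summable simp: infsumI)

  \<comment> \<open>Variation of the glued map\<close>
  moreover have "has_variation R \<epsilon> X \<beta>"
    unfolding has_variation_def
  proof (intro ballI impI)
    fix x y
    assume xy: "x \<in> X" "y \<in> X" "dist x y \<le> R"
    define d where "d i = \<epsilon>\<^sup>2 / 2 * a x i + 2 * \<bar>a x i - a y i\<bar>" for i
    have "(\<lambda>i. a x i - a y i) summable_on I"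
      using summable_on_add[of "a x" I "\<lambda>i. - a y i"] a_sum[OF xy(1)] a_sum[OF xy(2)]
      by (auto dest: has_sum_imp_summable simp: summable_on_uminus)
    then have var_sum: "(\<lambda>i. \<bar>a x i - a y i\<bar>) summable_on I"
      using summable_on_iff_abs_summable_on_real by force
    have d_sum: "(d has_sum (\<epsilon>\<^sup>2 / 2 + 2 * (\<Sum>\<^sub>\<infinity>i\<in>I. \<bar>a x i - a y i\<bar>))) I"
      unfolding d_def
      using has_sum_add[OF has_sum_cmult_right[OF a_sum[OF xy(1)], of "\<epsilon>\<^sup>2 / 2"]
          has_sum_cmult_right[OF has_sum_infsum[OF var_sum], of 2]] by simp
    have row_le: "(\<Sum>\<^sub>\<infinity>w\<in>X. (p x i w - p y i w)\<^sup>2) \<le> d i" if i: "i \<in> I" for i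
    \<comment> \<open>If both weights vanish, both rows are zero. If one does not, the thickening
      puts both points into \<open>Z i\<close>, so the variation bound of \<open>\<xi> i\<close>
      applies to the pair.\<close>
    proof (cases "a x i = 0 \<and> a y i = 0")
      case True
      then show ?thesis by (simp add: p_def d_def)
    next
      case False
      then have Zxy: "x \<in> Z i" "y \<in> Z i"
        using Z_of_a Z_near[of x y i] Z_near[of y x i] xy i by (auto simp: dist_commute)
      let ?u = "\<lambda>w. \<xi> i x w" and ?v = "\<lambda>w. \<xi> i y w"
      \<comment> \<open>The variation bound does not by itself yield convergence, because an
        infinite sum that fails to converge has the default value 0.\<close>
      have diff: "(\<lambda>w. (cmod (?u w - ?v w))\<^sup>2) summable_on X"
      proof (rule summable_on_comparison_test)
        show "(\<lambda>w. 2 * (cmod (?u w))\<^sup>2 + 2 * (cmod (?v w))\<^sup>2) summable_on X"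
          using \<xi>_sum Zxy i
          by (intro summable_on_add summable_on_cmult_right) (auto intro: has_sum_imp_summable)
        show "(cmod (?u w - ?v w))\<^sup>2 \<le> 2 * (cmod (?u w))\<^sup>2 + 2 * (cmod (?v w))\<^sup>2" for w
        proof -
          have "(cmod (?u w - ?v w))\<^sup>2 \<le> (cmod (?u w) + cmod (?v w))\<^sup>2"
            by (intro power_mono norm_triangle_ineq4) auto
          then show ?thesis
            using zero_le_power2[of "cmod (?u w) - cmod (?v w)"]
            by (simp add: power2_eq_square algebra_simps)
        qed
      qed auto
      have "(\<Sum>\<^sub>\<infinity>w\<in>X. (cmod (?u w - ?v w))\<^sup>2) = (\<Sum>\<^sub>\<infinity>w\<in>Z i. (cmod (?u w - ?v w))\<^sup>2)"
        using \<xi>_0 Zxy i ZX[of i] by (intro infsum_cong_neutral) auto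
      then have diff_le: "(\<Sum>\<^sub>\<infinity>w\<in>X. (cmod (?u w - ?v w))\<^sup>2) \<le> (\<epsilon> / 2)\<^sup>2"
        using has_variation_infsum_le[OF \<xi>(2)[OF i] Zxy xy(3)] by simp
      have bound: "((\<lambda>w. 2 * a x i * (cmod (?u w - ?v w))\<^sup>2 + 2 * \<bar>a x i - a y i\<bar> * (cmod (?v w))\<^sup>2)
          has_sum (2 * a x i * (\<Sum>\<^sub>\<infinity>w\<in>X. (cmod (?u w - ?v w))\<^sup>2) + 2 * \<bar>a x i - a y i\<bar> * 1)) X"
        using diff \<xi>_sum[OF Zxy(2) i] by (intro has_sum_add has_sum_cmult_right) auto
      have "(\<Sum>\<^sub>\<infinity>w\<in>X. (p x i w - p y i w)\<^sup>2)
          \<le> 2 * a x i * (\<Sum>\<^sub>\<infinity>w\<in>X. (cmod (?u w - ?v w))\<^sup>2) + 2 * \<bar>a x i - a y i\<bar> * 1"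
      proof (rule has_sum_mono[OF has_sum_infsum bound])
        show "(\<lambda>w. (p x i w - p y i w)\<^sup>2) summable_on X"
          using p_row xy i by (intro summable_on_diff_square) (auto intro: has_sum_imp_summable)
      qed (simp add: p_def weighted_square_diff_le a_nonneg xy i)
      also have "\<dots> \<le> 2 * a x i * (\<epsilon> / 2)\<^sup>2 + 2 * \<bar>a x i - a y i\<bar> * 1"
        using diff_le a_nonneg[OF xy(1) i] by (intro add_right_mono mult_left_mono) auto
      also have "\<dots> = d i"
        by (simp add: d_def power2_eq_square)
      finally show ?thesis .
    qed
    have "(cmod (\<beta> x w - \<beta> y w))\<^sup>2 = (sqrt (\<Sum>\<^sub>\<infinity>i\<in>I. (p x i w)\<^sup>2) - sqrt (\<Sum>\<^sub>\<infinity>i\<in>I. (p y i w)\<^sup>2))\<^sup>2" for w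
      unfolding \<beta>_def of_real_diff[symmetric] norm_of_real by simp
    then have "(\<Sum>\<^sub>\<infinity>w\<in>X. (cmod (\<beta> x w - \<beta> y w))\<^sup>2) \<le> (\<Sum>\<^sub>\<infinity>i\<in>I. d i)"
      using p_row row_le xy has_sum_imp_summable[OF a_sum] has_sum_imp_summable[OF d_sum]
      by (auto intro!: infsum_fibre_norm_diff_le[where a = "a x" and b = "a y"])
    also have "\<dots> = \<epsilon>\<^sup>2 / 2 + 2 * (\<Sum>\<^sub>\<infinity>i\<in>I. \<bar>a x i - a y i\<bar>)"
      using d_sum by (rule infsumI)
    also have "\<dots> \<le> \<epsilon>\<^sup>2"
      using a_var[OF xy] by simp
    finally show "ell2_norm X (\<lambda>w. \<beta> x w - \<beta> y w) \<le> \<epsilon>"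
      unfolding ell2_norm_def using \<epsilon> by (intro real_le_lsqrt) auto
  qed

  \<comment> \<open>Tails of the glued map\<close>
  moreover have "((\<lambda>S. tail_sup X \<beta> S) \<longlongrightarrow> 0) at_top"
  proof (rule tendsto_sandwich[OF _ _ tendsto_const tail])
    have "ennreal (\<Sum>\<^sub>\<infinity>w\<in>X - cball x r. (cmod (\<beta> x w))\<^sup>2) \<le> (SUP i\<in>I. tail_sup (Z i) (\<xi> i) r)"
      if x: "x \<in> X" for x r
    \<comment> \<open>The supremum lives in \<open>ennreal\<close>. If it is infinite the bound is
      trivial; otherwise it is a real \<open>t\<close> and the estimate can be made with real
      sums.\<close>
    proof (cases "SUP i\<in>I. tail_sup (Z i) (\<xi> i) r")
      case (real t)
      let ?B = "X - cball x r"
      \<comment> \<open>The mass of \<open>\<beta> x\<close> outside the ball is the sum of the row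
        masses \<open>g i\<close>. Each is \<open>a x i\<close> times a tail of
        \<open>\<xi> i x\<close>, or zero, hence at most \<open>t * a x i\<close>; the weights sum
        to 1, so the total is at most \<open>t\<close>.\<close>
      define g where "g i = (\<Sum>\<^sub>\<infinity>w\<in>?B. (p x i w)\<^sup>2)" for i
      have g_le: "g i \<le> t * a x i" if i: "i \<in> I" for i
      proof (cases "a x i = 0")
        case True
        then show ?thesis by (simp add: g_def p_def)
      next
        case False
        then have Zx: "x \<in> Z i"
          using Z_of_a x i by blast
        have "g i = a x i * (\<Sum>\<^sub>\<infinity>w\<in>?B. (cmod (\<xi> i x w))\<^sup>2)"
          by (simp add: g_def p_sq x i infsum_cmult_right')
        also have "(\<Sum>\<^sub>\<infinity>w\<in>?B. (cmod (\<xi> i x w))\<^sup>2) = (\<Sum>\<^sub>\<infinity>w\<in>Z i - cball x r. (cmod (\<xi> i x w))\<^sup>2)"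
          using \<xi>_0 Zx i ZX[of i] by (intro infsum_cong_neutral) auto
        finally have g: "g i = a x i * (\<Sum>\<^sub>\<infinity>w\<in>Z i - cball x r. (cmod (\<xi> i x w))\<^sup>2)" .
        have "ennreal (\<Sum>\<^sub>\<infinity>w\<in>Z i - cball x r. (cmod (\<xi> i x w))\<^sup>2) \<le> tail_sup (Z i) (\<xi> i) r"
          unfolding tail_sup_def using Zx by (rule SUP_upper)
        also have "\<dots> \<le> ennreal t"
          unfolding real(2)[symmetric] using i by (rule SUP_upper)
        finally have "(\<Sum>\<^sub>\<infinity>w\<in>Z i - cball x r. (cmod (\<xi> i x w))\<^sup>2) \<le> t"
          using real(1) by simp
        then show ?thesis
          unfolding g using a_nonneg[OF x i] by (simp add: mult.commute[of t] mult_left_mono)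
      qed
      have rows: "((\<lambda>w. (p x i w)\<^sup>2) has_sum g i) ?B" if "i \<in> I" for i
        unfolding g_def
        using summable_on_subset_banach[OF has_sum_imp_summable[OF p_row[OF x that]]]
        by (intro has_sum_infsum) auto
      have ta: "((\<lambda>i. t * a x i) has_sum t) I"
        using has_sum_cmult_right[OF a_sum[OF x], of t] by simp
      have g_sum: "g summable_on I"
        using g_le
        by (intro summable_on_comparison_test[OF has_sum_imp_summable[OF ta]])
          (auto simp: g_def intro: infsum_nonneg)
      have "(\<Sum>\<^sub>\<infinity>w\<in>?B. (cmod (\<beta> x w))\<^sup>2) = (\<Sum>\<^sub>\<infinity>i\<in>I. g i)"
        unfolding \<beta>_sq using rows g_sum
        by (intro infsumI nonneg_iterated_has_sum_swap[where g = g]) auto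
      also have "\<dots> \<le> t"
        using g_le by (intro has_sum_mono[OF has_sum_infsum[OF g_sum] ta]) auto
      finally show ?thesis
        unfolding real(2) by (rule ennreal_leI)
    next
      case top
      show ?thesis
        unfolding top by (rule top_greatest)
    qed
    then show "\<forall>\<^sub>F r in at_top. tail_sup X \<beta> r \<le> (SUP i\<in>I. tail_sup (Z i) (\<xi> i) r)"
      unfolding tail_sup_def[of X] by (intro always_eventually allI SUP_least)
  qed simp
  ultimately show "\<exists>\<beta>. unit_ell2_map X \<beta> \<and> has_variation R \<epsilon> X \<beta> \<and>
      ((\<lambda>S. tail_sup X \<beta> S) \<longlongrightarrow> 0) at_top"
    by blast
qed

end
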